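(* Let $R$ be a commutative topological ring which is Hausdorff, and suppose that for some $0\neq x\in Z(R)$ the map $f:R\rightarrow R$ given by $r\mapsto rx$ is a closed map. If $Z(R)$ is a compact subset of $R$, then $R$ is compact.
   Context: Rings are commutative with identity. A topological ring is a ring with a topology for which the ring operations are continuous. $Z(R)=\{a\in R:\operatorname{Ann}(a)\neq 0\}$ is the set of all zerodivisors of $R$, where $\operatorname{Ann}(a)=\{r\in R: ra=0\}$. A compact space is a quasi-compact (every open cover has a finite subcover) and Hausdorff space; compactness of a subset refers to the subspace topology. A closed map is one that sends closed sets to closed sets. *)

theory Defs
  imports "HOL-Analysis.Analysis"
begin

text \<open>
  The class \<^class>\<open>comm_ring_1\<close> includes \<open>0 \<noteq> 1\<close>, so the zero ring is excluded.
\<close>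

class topological_comm_ring_1 = comm_ring_1 + topological_ab_group_add + topological_monoid_mult

definition annihilator :: "'a::comm_ring_1 \<Rightarrow> 'a set" where
  "annihilator a = {r. r * a = 0}"

text \<open>Here \<open>0\<close> counts as a zerodivisor, since its annihilator is the whole (nonzero) ring.\<close>

definition zerodivisors :: "'a::comm_ring_1 set" where
  "zerodivisors = {a. annihilator a \<noteq> {0}}"

end

theory Submission
  imports Defs
begin

text \<open>
  Write \<open>f r = r * x\<close>. The two facts that make \<open>x\<close> useful are that both the kernel and the
  image of \<open>f\<close> consist of zerodivisors: the kernel because \<open>x \<noteq> 0\<close>, the image because \<open>x\<close> is
  a zerodivisor. The kernel is closed because the ring is Hausdorff, and the image is closed because
  \<open>f\<close> is a closed map, so both are compact. The fibres of \<open>f\<close> are empty or translates of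
  the kernel; hence \<open>f\<close> is a closed map with compact fibres, that is, a proper map. Proper maps pull
  compact sets back to compact sets, and the whole ring is the preimage of the compact image.
\<close>

lemma zerodivisors_iff:
  fixes a :: "'a::comm_ring_1"
  shows "a \<in> zerodivisors \<longleftrightarrow> (\<exists>y. y \<noteq> 0 \<and> y * a = 0)"
proof -
  have "0 \<in> annihilator a"
    unfolding annihilator_def by simp
  then have "annihilator a \<noteq> {0} \<longleftrightarrow> (\<exists>y. y \<noteq> 0 \<and> y \<in> annihilator a)"
    by blast
  then show ?thesis
    unfolding zerodivisors_def annihilator_def mem_Collect_eq .
qed

lemma annihilator_subset_zerodivisors:
  fixes x :: "'a::comm_ring_1"
  assumes "x \<noteq> 0"
  shows "annihilator x \<subseteq> zerodivisors"
proof
  fix a assume "a \<in> annihilator x"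
  then have "x * a = 0"
    unfolding annihilator_def by (simp add: mult.commute)
  with assms show "a \<in> zerodivisors"
    unfolding zerodivisors_iff by blast
qed

lemma range_mult_subset_zerodivisors:
  fixes x :: "'a::comm_ring_1"
  assumes "x \<in> zerodivisors"
  shows "range (\<lambda>r. r * x) \<subseteq> zerodivisors"
proof -
  from assms obtain y where "y \<noteq> 0" "y * x = 0"
    unfolding zerodivisors_iff by blast
  moreover from \<open>y * x = 0\<close> have "y * (r * x) = 0" for r
    by (simp add: mult.left_commute)
  ultimately show ?thesis
    using zerodivisors_iff by blast
qed

lemma continuous_mult_right:
  fixes x :: "'a::topological_comm_ring_1"
  shows "continuous_on UNIV (\<lambda>r. r * x)"
  by (intro continuous_on_mult' continuous_on_id continuous_on_const)

lemma closed_annihilator: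
  fixes x :: "'a::{topological_comm_ring_1, t2_space}"
  shows "closed (annihilator x)"
  unfolding annihilator_def
  by (intro closed_Collect_eq continuous_mult_right continuous_on_const)

lemma mult_fibre_eq_translate:
  fixes x s :: "'a::comm_ring_1"
  shows "{r. r * x = s * x} = (\<lambda>a. s + a) ` annihilator x"
proof (intro set_eqI iffI)
  fix r assume "r \<in> {r. r * x = s * x}"
  then have "r - s \<in> annihilator x"
    by (simp add: annihilator_def left_diff_distrib)
  then show "r \<in> (\<lambda>a. s + a) ` annihilator x"
    by (rule image_eqI[rotated]) simp
qed (auto simp: annihilator_def distrib_right)

lemma compact_mult_fibre:
  fixes x y :: "'a::topological_comm_ring_1"
  assumes "compact (annihilator x)"
  shows "compact {r. r * x = y}"
proof (cases "y \<in> range (\<lambda>r. r * x)")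
  case True
  then obtain s where "y = s * x"
    by blast
  moreover have "compact ((\<lambda>a. s + a) ` annihilator x)"
    using assms by (intro compact_continuous_image continuous_intros)
  ultimately show ?thesis
    by (simp add: mult_fibre_eq_translate)
next
  case False
  then have "{r. r * x = y} = {}"
    by blast
  then show ?thesis
    by simp
qed

theorem theorem2p25:
  assumes "\<exists>x::'a::{topological_comm_ring_1, t2_space}.
             x \<noteq> 0 \<and> x \<in> zerodivisors \<and> closed_map euclidean euclidean (\<lambda>r::'a. r * x)"
    and "compact (zerodivisors :: 'a set)"
  shows "compact (UNIV :: 'a set)"
proof -
  from assms(1) obtain x :: 'a
    where x: "x \<noteq> 0" "x \<in> zerodivisors"
      and closed_map: "closed_map euclidean euclidean (\<lambda>r::'a. r * x)"
    by blast
  have "compact (zerodivisors \<inter> annihilator x)"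
    using assms(2) closed_annihilator by (rule compact_Int_closed)
  then have kernel: "compact (annihilator x)"
    using annihilator_subset_zerodivisors[OF x(1)] by (simp add: Int_absorb1)
  have "closed (range (\<lambda>r. r * x))"
    using closed_map by (simp add: closed_map_def)
  with assms(2) have "compact (zerodivisors \<inter> range (\<lambda>r. r * x))"
    by (rule compact_Int_closed)
  then have image: "compact (range (\<lambda>r. r * x))"
    using range_mult_subset_zerodivisors[OF x(2)] by (simp add: Int_absorb1)
  have "proper_map euclidean euclidean (\<lambda>r. r * x)"
    using closed_map compact_mult_fibre[OF kernel] by (simp add: proper_map_def)
  from compactin_proper_map_preimage[OF this, of "range (\<lambda>r. r * x)"] image
  show ?thesis
    by simp
qed

end
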